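(* Let $r,b,d\ge 1$ be integers and, for $i,n\in\mathbf{N}\cup\{0\}$, let $q_{r,b}(i,n)=(r+id)/(r+b+nd)$. Then $$\mathrm{supp}(S_{r,b})=\{q_{r,b}(i,n)\mid 0\le i\le n,\ q_{r,b}(i,n)\ge r/(r+b)\}$$ and $$\mathrm{supp}(M_{r,b})=\mathrm{supp}(S_{r,b+d})\cup\mathrm{supp}(S_{r+d,b}).$$ In particular, for $d=1$, $\mathrm{supp}(S_{r,b})=[r/(r+b),1)\cap\mathbf{Q}$.
   Context: P\'olya's urn with integer parameters $r,b,d\ge 1$: the urn initially contains $r$ red and $b$ black balls. In each draw one ball is taken uniformly at random from the urn, and this ball together with another $d$ balls of the same color is put into the urn. $R_n$ is the number of red balls in the urn after the $n$th draw ($R_0=r$), and $Z_n=R_n/(nd+r+b)$. $S_{r,b}=\sup_{n\ge 0}Z_n$ and $M_{r,b}=\sup_{n\ge 1}Z_n$; $S_{r,b+d}$ and $S_{r+d,b}$ are the corresponding quantities for the urns with the indicated initial numbers of red and black balls and the same $d$. For a random variable $U$, $\mathrm{supp}(U)$ denotes the set of values taken with positive probability, $\{x:\mathbf{P}(U=x)>0\}$. *)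

theory Defs
  imports "HOL-Probability.Probability"
begin

datatype colour = Red | Black

(* The content of the urn after n draws; c k is the colour of the ball drawn in draw k + 1. *)
primrec urn :: "nat \<Rightarrow> nat \<Rightarrow> nat \<Rightarrow> (nat \<Rightarrow> colour) \<Rightarrow> nat \<Rightarrow> colour multiset" where
  "urn r b d c 0 = replicate_mset r Red + replicate_mset b Black"
| "urn r b d c (Suc n) = urn r b d c n + replicate_mset d (c n)"

(* C is the sequence of drawn colours of a Polya urn: given the colours h of the first n draws
   (a history of positive probability), the next ball is uniform in the current urn. *)
definition polya_urn ::
    "nat \<Rightarrow> nat \<Rightarrow> nat \<Rightarrow> 'a measure \<Rightarrow> (nat \<Rightarrow> 'a \<Rightarrow> colour) \<Rightarrow> bool" where
  "polya_urn r b d M C \<longleftrightarrow>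
     prob_space M \<and>
     (\<forall>n. C n \<in> M \<rightarrow>\<^sub>M count_space UNIV) \<and>
     (\<forall>n h c. \<P>(\<omega> in M. \<forall>k<n. C k \<omega> = h k) > 0 \<longrightarrow>
        \<P>(\<omega> in M. C n \<omega> = c \<bar> \<forall>k<n. C k \<omega> = h k) = pmf (pmf_of_multiset (urn r b d h n)) c)"

definition R :: "nat \<Rightarrow> nat \<Rightarrow> nat \<Rightarrow> (nat \<Rightarrow> 'a \<Rightarrow> colour) \<Rightarrow> nat \<Rightarrow> 'a \<Rightarrow> nat" where
  "R r b d C n \<omega> = count (urn r b d (\<lambda>k. C k \<omega>) n) Red"

definition Z :: "nat \<Rightarrow> nat \<Rightarrow> nat \<Rightarrow> (nat \<Rightarrow> 'a \<Rightarrow> colour) \<Rightarrow> nat \<Rightarrow> 'a \<Rightarrow> real" where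
  "Z r b d C n \<omega> = real (R r b d C n \<omega>) / real (n * d + r + b)"

(* The suprema below are over nonempty subsets of [0,1] (lemma Z_bounds). *)
definition S_sup :: "nat \<Rightarrow> nat \<Rightarrow> nat \<Rightarrow> (nat \<Rightarrow> 'a \<Rightarrow> colour) \<Rightarrow> 'a \<Rightarrow> real" where
  "S_sup r b d C \<omega> = (SUP n. Z r b d C n \<omega>)"

definition M_sup :: "nat \<Rightarrow> nat \<Rightarrow> nat \<Rightarrow> (nat \<Rightarrow> 'a \<Rightarrow> colour) \<Rightarrow> 'a \<Rightarrow> real" where
  "M_sup r b d C \<omega> = (SUP n\<in>{1..}. Z r b d C n \<omega>)"

definition supp :: "'a measure \<Rightarrow> ('a \<Rightarrow> real) \<Rightarrow> real set" where
  "supp M U = {x. \<P>(\<omega> in M. U \<omega> = x) > 0}"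

definition q :: "nat \<Rightarrow> nat \<Rightarrow> nat \<Rightarrow> nat \<Rightarrow> nat \<Rightarrow> real" where
  "q r b d i n = real (r + i * d) / real (r + b + n * d)"


lemma size_urn: "size (urn r b d c n) = n * d + r + b"
  by (induction n) auto

lemma Z_bounds: "Z r b d C n \<omega> \<in> {0..1}"
proof -
  have "R r b d C n \<omega> \<le> n * d + r + b"
    unfolding R_def using count_le_size size_urn by metis
  then have "real (R r b d C n \<omega>) \<le> real (n * d + r + b)"
    by (rule of_nat_mono)
  then show ?thesis
    unfolding Z_def by (auto simp: divide_le_eq_1)
qed

lemma urn_cong: "(\<And>k. k < n \<Longrightarrow> c k = c' k) \<Longrightarrow> urn r b d c n = urn r b d c' n"
  by (induction n) auto

instance colour :: finite
proof
  have "(UNIV :: colour set) = {Red, Black}"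
    by (auto intro: colour.exhaust)
  then show "finite (UNIV :: colour set)"
    by (metis finite.emptyI finite.insertI)
qed

lemma polya_urn_exists:
  "\<exists>(M :: (nat \<Rightarrow> colour) measure) C. polya_urn r b d M C"
proof -
  let ?N = "\<lambda>_::nat. count_space (UNIV :: colour set)"
  define K where "K n h = measure_pmf (pmf_of_multiset (urn r b d h n))" for n h
  have PiM_eq: "PiM {0..<n} ?N = count_space (PiE {0..<n} (\<lambda>_. UNIV))" for n
    by (rule count_space_PiM_finite) auto
  interpret IT: Ionescu_Tulcea K ?N
  proof (rule Ionescu_Tulcea.intro)
    show "K n \<in> PiM {0..<n} ?N \<rightarrow>\<^sub>M subprob_algebra (count_space UNIV)" for n
      unfolding PiM_eq K_def
      by (auto simp: space_subprob_algebra intro!: prob_space_imp_subprob_space measure_pmf.prob_space_axioms)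
    show "prob_space (K n h)" for n h
      unfolding K_def by (rule measure_pmf.prob_space_axioms)
  qed
  let ?L = "IT.PF.lim"
  have sets_L: "sets ?L = sets (PiM UNIV ?N)"
    by (rule IT.PF.sets_lim)
  let ?u = "\<lambda>x::nat. undefined :: colour"
  have step: "emeasure (IT.C 0 (Suc n) ?u) {restrict h {0..<Suc n}} =
      emeasure (IT.C 0 n ?u) {restrict h {0..<n}} * emeasure (K n h) {h n}" for n h
  proof -
    let ?h = "restrict h {0..<n}" and ?h' = "restrict h {0..<Suc n}"
    have u: "?u \<in> space (PiM {0..<0} ?N)" by (simp add: space_PiM)
    have sC: "sets (IT.C 0 n ?u) = sets (PiM {0..<n} ?N)"
      using IT.sets_C[OF u, of n] by simp
    have spC: "space (IT.C 0 n ?u) = space (PiM {0..<n} ?N)"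
      using sets_eq_imp_space_eq[OF sC] .
    have m: "IT.eP n \<in> IT.C 0 n ?u \<rightarrow>\<^sub>M subprob_algebra (PiM {0..<Suc n} ?N)"
      using IT.measurable_eP[of n] measurable_cong_sets[OF sC refl] by blast
    have ne: "space (IT.C 0 n ?u) \<noteq> {}"
      using prob_space.not_empty[OF IT.prob_space_C[OF u]] .
    have h'[measurable]: "{?h'} \<in> sets (PiM {0..<Suc n} ?N)"
      unfolding PiM_eq by auto
    have hs: "{?h} \<in> sets (IT.C 0 n ?u)"
      unfolding sC PiM_eq by auto
    have Kh: "K n ?h = K n h"
      unfolding K_def by (subst urn_cong[of n ?h h]) auto
    have "emeasure (IT.C 0 (Suc n) ?u) {?h'} = (\<integral>\<^sup>+x. emeasure (IT.eP n x) {?h'} \<partial>IT.C 0 n ?u)"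
      by (simp add: emeasure_bind[OF ne m h'])
    also have "\<dots> = (\<integral>\<^sup>+x. emeasure (K n h) {h n} * indicator {?h} x \<partial>IT.C 0 n ?u)"
    proof (rule nn_integral_cong)
      fix x assume "x \<in> space (IT.C 0 n ?u)"
      then have x: "x \<in> space (PiM {0..<n} ?N)" by (simp add: spC)
      have xe: "x \<in> extensional {0..<n}" using x by (auto simp: space_PiM PiE_iff)
      have upd: "x(n := c) = ?h' \<longleftrightarrow> x = ?h \<and> c = h n" for c
      proof
        assume e: "x(n := c) = ?h'"
        have "c = h n" using fun_cong[OF e, of n] by simp
        moreover have "x = ?h"
        proof
          fix k show "x k = ?h k"
            using fun_cong[OF e, of k] xe by (cases "k < n") (auto simp: extensional_def)
        qed
        ultimately show "x = ?h \<and> c = h n" by simp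
      next
        assume "x = ?h \<and> c = h n"
        then show "x(n := c) = ?h'" by (auto simp: fun_eq_iff restrict_def)
      qed
      have "emeasure (IT.eP n x) {?h'} = emeasure (K n x) ((\<lambda>c. x(n := c)) -` {?h'} \<inter> space (?N n))"
        by (rule IT.emeasure_eP[OF x h'])
      also have "(\<lambda>c. x(n := c)) -` {?h'} \<inter> space (?N n) = (if x = ?h then {h n} else {})"
        using upd by (auto simp del: restrict_apply)
      finally show "emeasure (IT.eP n x) {?h'} = emeasure (K n h) {h n} * indicator {?h} x"
        using Kh by (auto simp del: restrict_apply)
    qed
    also have "\<dots> = emeasure (K n h) {h n} * emeasure (IT.C 0 n ?u) {?h}"
      by (rule nn_integral_cmult_indicator[OF hs])
    finally show ?thesis by (simp only: mult.commute)
  qed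
  have cyl: "emeasure ?L {\<omega>. \<forall>k<n. \<omega> k = h k} = emeasure (IT.C 0 n ?u) {restrict h {0..<n}}" for n h
  proof -
    let ?X = "{restrict h {0..<n}}"
    have X: "?X \<in> sets (PiM {0..<n} ?N)" unfolding PiM_eq by auto
    have E: "{\<omega>. \<forall>k<n. \<omega> k = h k} = IT.PF.emb UNIV {0..<n} ?X"
      by (auto simp: prod_emb_def fun_eq_iff restrict_def) metis
    have "emeasure ?L {\<omega>. \<forall>k<n. \<omega> k = h k} = emeasure (IT.CI {0..<n}) ?X"
      unfolding E by (rule IT.lim[OF _ X]) simp
    also have "\<dots> = emeasure (IT.C 0 n ?u) (IT.PF.emb {0..<n} {0..<n} ?X)"
      by (rule IT.emeasure_CI[OF _ X]) simp
    also have "IT.PF.emb {0..<n} {0..<n} ?X = ?X"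
      by (rule prod_emb_id) auto
    finally show ?thesis .
  qed
  have "polya_urn r b d ?L (\<lambda>n \<omega>. \<omega> n)"
    unfolding polya_urn_def
  proof (intro conjI allI impI)
    have "emeasure ?L (space ?L) = 1"
      using cyl[of 0 "\<lambda>_. undefined"] by (simp add: space_PiM PiM_empty restrict_def)
    then show "prob_space ?L" by (rule prob_spaceI)
    show "(\<lambda>\<omega>. \<omega> n) \<in> ?L \<rightarrow>\<^sub>M count_space UNIV" for n
      unfolding measurable_cong_sets[OF sets_L refl]
      by (rule measurable_component_singleton) simp
    fix n h c
    assume pos: "\<P>(\<omega> in ?L. \<forall>k<n. \<omega> k = h k) > 0"
    have Kc: "emeasure (K n h) {c} = ennreal (pmf (pmf_of_multiset (urn r b d h n)) c)"
      by (simp add: K_def emeasure_pmf_single)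
    let ?g = "h(n := c)"
    have E: "{\<omega>. \<omega> n = c \<and> (\<forall>k<n. \<omega> k = h k)} = {\<omega>. \<forall>k<Suc n. \<omega> k = ?g k}"
      by (auto simp: less_Suc_eq)
    have "emeasure ?L {\<omega>. \<omega> n = c \<and> (\<forall>k<n. \<omega> k = h k)} =
        emeasure ?L {\<omega>. \<forall>k<n. \<omega> k = ?g k} * emeasure (K n ?g) {?g n}"
      unfolding E by (simp only: cyl step)
    also have "{\<omega>. \<forall>k<n. \<omega> k = ?g k} = {\<omega>. \<forall>k<n. \<omega> k = h k}" by auto
    also have "K n ?g = K n h"
      unfolding K_def by (subst urn_cong[of n ?g h]) auto
    finally have "measure ?L {\<omega>. \<omega> n = c \<and> (\<forall>k<n. \<omega> k = h k)} =
        measure ?L {\<omega>. \<forall>k<n. \<omega> k = h k} * pmf (pmf_of_multiset (urn r b d h n)) c"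
      using Kc by (simp add: measure_def enn2real_mult)
    then show "\<P>(\<omega> in ?L. \<omega> n = c \<bar> \<forall>k<n. \<omega> k = h k) = pmf (pmf_of_multiset (urn r b d h n)) c"
      using pos by (simp add: cond_prob_def space_PiM)
  qed
  then show ?thesis by blast
qed

end

theory Submission
  imports Defs "HOL-Real_Asymp.Real_Asymp"
begin

text \<open>
  Everything is reduced to the first draw: conditioned on a red (black) first ball, the remaining
  draws come from the urn started with \<open>(r + d, b)\<close> (with \<open>(r, b + d)\<close>)
  (\<open>first_draw\<close>). Since \<open>M_sup\<close> is the supremum over the path after the first draw, this
  settles the claim about \<open>M_sup\<close> once the support of \<open>S_sup\<close> is known for all urns.

  Every value \<open>q r b d i n\<close> in the set is taken with positive probability: if the
  \<open>n - i\<close> black balls are drawn before the \<open>i\<close> red ones, the proportion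
  first decreases and then increases, so it never exceeds the larger of its end points, which is
  the target. It remains to see that with positive probability the proportion never exceeds its
  starting value (\<open>start_in_supp\<close>): a first black draw lowers it strictly, and the maximal
  inequality for the nonnegative martingale \<open>Z\<close> bounds the probability of a return by a
  number smaller than 1.

  Conversely, if the supremum is attained, it is one of the values \<open>q r b d i n\<close> and at
  least \<open>Z\<^sub>0\<close>. So the point is that a fixed \<open>x\<close> is almost surely not an unattained
  supremum (\<open>prob_unattained\<close>). If it is one, the path returns close to \<open>x\<close> at
  arbitrarily late times. As \<open>Z\<close> hardly moves after a late time \<open>N\<close>
  (\<open>prob_unsettled_le\<close>), \<open>Z\<^sub>N\<close> itself must be close to \<open>x\<close>. But for
  \<open>r, b \<ge> d\<close> no value of \<open>R\<^sub>n\<close> has probability above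
  \<open>(r + b) / (r + b + n d)\<close> (\<open>prob_R_le\<close>), so that \<open>Z\<^sub>N\<close> is in a window of
  width \<open>\<epsilon>\<close> only with probability of order \<open>\<epsilon>\<close>. Urns with fewer than
  \<open>d\<close> balls of a colour reach this case as soon as that colour is drawn, and
  \<open>power_decay\<close> quantifies that the other colour is almost surely not drawn forever.
\<close>

section \<open>Conditioning on the first draw\<close>

definition after :: "'a measure \<Rightarrow> (nat \<Rightarrow> 'a \<Rightarrow> colour) \<Rightarrow> colour \<Rightarrow> 'a measure" where
  "after M C c = uniform_measure M {\<omega> \<in> space M. C 0 \<omega> = c}"

lemma space_after [simp]: "space (after M C c) = space M"
  and sets_after [simp, measurable_cong]: "sets (after M C c) = sets M"
  by (simp_all add: after_def)

lemma polya_urnD: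
  assumes "polya_urn r b d M C"
  shows "prob_space M" and "C n \<in> M \<rightarrow>\<^sub>M count_space UNIV"
  using assms by (auto simp: polya_urn_def)

lemma polya_urn_cond:
  assumes "polya_urn r b d M C" and "\<P>(\<omega> in M. \<forall>k<n. C k \<omega> = h k) > 0"
  shows "\<P>(\<omega> in M. C n \<omega> = c \<bar> \<forall>k<n. C k \<omega> = h k) = pmf (pmf_of_multiset (urn r b d h n)) c"
  using assms by (simp add: polya_urn_def)

lemma pmf_urn:
  assumes "0 < r + b"
  shows "pmf (pmf_of_multiset (urn r b d h n)) c = count (urn r b d h n) c / real (n * d + r + b)"
proof -
  have "urn r b d h n \<noteq> {#}"
    using assms size_urn[of r b d h n] by (auto simp del: urn.simps)
  then show ?thesis by (simp add: size_urn)
qed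

lemma prob_first_draw:
  assumes "polya_urn r b d M C" and "0 < r"
  shows "\<P>(\<omega> in M. C 0 \<omega> = Red) = real r / real (r + b)"
    and "\<P>(\<omega> in M. C 0 \<omega> = Black) = real b / real (r + b)"
proof -
  interpret prob_space M using assms by (simp add: polya_urnD)
  have "\<P>(\<omega> in M. C 0 \<omega> = c) = pmf (pmf_of_multiset (urn r b d (\<lambda>_. Red) 0)) c" for c
  proof -
    have "\<P>(\<omega> in M. \<forall>k<0. C k \<omega> = Red) > 0"
      by (simp add: prob_space)
    from polya_urn_cond[OF assms(1) this] have "\<P>(\<omega> in M. C 0 \<omega> = c \<bar> \<forall>k<0. C k \<omega> = Red)
        = pmf (pmf_of_multiset (urn r b d (\<lambda>_. Red) 0)) c"
      .
    then show ?thesis by (simp add: cond_prob_def prob_space)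
  qed
  then show "\<P>(\<omega> in M. C 0 \<omega> = Red) = real r / real (r + b)"
    and "\<P>(\<omega> in M. C 0 \<omega> = Black) = real b / real (r + b)"
    using pmf_urn[of r b d _ 0] assms(2) by simp_all
qed

lemma urn_Suc:
  "c 0 = Red \<Longrightarrow> urn r b d c (Suc n) = urn (r + d) b d (\<lambda>k. c (Suc k)) n"
  "c 0 = Black \<Longrightarrow> urn r b d c (Suc n) = urn r (b + d) d (\<lambda>k. c (Suc k)) n"
  by (induction n) (auto simp: multiset_eq_iff)

lemma prob_after:
  assumes "polya_urn r b d M C" and "{\<omega> \<in> space M. \<phi> \<omega>} \<in> sets M"
    and pos: "\<P>(\<omega> in M. C 0 \<omega> = c) > 0"
  shows "\<P>(\<omega> in after M C c. \<phi> \<omega>) = \<P>(\<omega> in M. C 0 \<omega> = c \<and> \<phi> \<omega>) / \<P>(\<omega> in M. C 0 \<omega> = c)"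
proof -
  interpret prob_space M using assms by (simp add: polya_urnD)
  have [measurable]: "C 0 \<in> M \<rightarrow>\<^sub>M count_space UNIV" using assms by (simp add: polya_urnD)
  have "{\<omega> \<in> space M. C 0 \<omega> = c} \<inter> {\<omega> \<in> space M. \<phi> \<omega>} = {\<omega> \<in> space M. C 0 \<omega> = c \<and> \<phi> \<omega>}"
    by auto
  then show ?thesis
    using pos assms(2) unfolding after_def
    by (subst measure_uniform_measure) (auto simp: emeasure_eq_measure)
qed

lemma polya_urn_after:
  assumes urn: "polya_urn r b d M C" and pos: "\<P>(\<omega> in M. C 0 \<omega> = c) > 0"
    and shift: "\<And>h n. h 0 = c \<Longrightarrow> urn r b d h (Suc n) = urn r' b' d (\<lambda>k. h (Suc k)) n"
  shows "polya_urn r' b' d (after M C c) (\<lambda>n. C (Suc n))"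
  unfolding polya_urn_def
proof (intro conjI allI impI)
  interpret prob_space M using assms by (simp add: polya_urnD)
  have [measurable]: "\<And>n. C n \<in> M \<rightarrow>\<^sub>M count_space UNIV" using assms by (simp add: polya_urnD)
  show "prob_space (after M C c)"
    unfolding after_def using pos
    by (intro prob_space_uniform_measure) (auto simp: emeasure_eq_measure)
  show "C (Suc n) \<in> after M C c \<rightarrow>\<^sub>M count_space UNIV" for n
    by measurable
  fix n h c'
  let ?h = "case_nat c h"
  have hist: "(C 0 \<omega> = c \<and> (\<forall>k<n. C (Suc k) \<omega> = h k)) \<longleftrightarrow> (\<forall>k<Suc n. C k \<omega> = ?h k)" for \<omega>
    by (auto simp: less_Suc_eq_0_disj)
  have hist': "(C 0 \<omega> = c \<and> C (Suc n) \<omega> = c' \<and> (\<forall>k<n. C (Suc k) \<omega> = h k))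
      \<longleftrightarrow> (C (Suc n) \<omega> = c' \<and> (\<forall>k<Suc n. C k \<omega> = ?h k))" for \<omega>
    using hist[of \<omega>] by blast
  have 1: "\<P>(\<omega> in after M C c. \<forall>k<n. C (Suc k) \<omega> = h k)
      = \<P>(\<omega> in M. \<forall>k<Suc n. C k \<omega> = ?h k) / \<P>(\<omega> in M. C 0 \<omega> = c)"
    by (subst prob_after[OF urn _ pos]) (simp_all add: hist)
  have 2: "\<P>(\<omega> in after M C c. C (Suc n) \<omega> = c' \<and> (\<forall>k<n. C (Suc k) \<omega> = h k))
      = \<P>(\<omega> in M. C (Suc n) \<omega> = c' \<and> (\<forall>k<Suc n. C k \<omega> = ?h k)) / \<P>(\<omega> in M. C 0 \<omega> = c)"
    by (subst prob_after[OF urn _ pos]) (simp_all add: hist')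
  assume "0 < \<P>(\<omega> in after M C c. \<forall>k<n. C (Suc k) \<omega> = h k)"
  then have "0 < \<P>(\<omega> in M. \<forall>k<Suc n. C k \<omega> = ?h k)"
    using pos unfolding 1 by (simp add: zero_less_divide_iff)
  then have "\<P>(\<omega> in M. C (Suc n) \<omega> = c' \<bar> \<forall>k<Suc n. C k \<omega> = ?h k)
      = pmf (pmf_of_multiset (urn r b d ?h (Suc n))) c'"
    by (rule polya_urn_cond[OF urn])
  also have "\<P>(\<omega> in M. C (Suc n) \<omega> = c' \<bar> \<forall>k<Suc n. C k \<omega> = ?h k)
      = \<P>(\<omega> in after M C c. C (Suc n) \<omega> = c' \<bar> \<forall>k<n. C (Suc k) \<omega> = h k)"
    using pos unfolding cond_prob_def 1 2 by simp
  also have "urn r b d ?h (Suc n) = urn r' b' d h n"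
    using shift[of ?h n] by simp
  finally show "\<P>(\<omega> in after M C c. C (Suc n) \<omega> = c' \<bar> \<forall>k<n. C (Suc k) \<omega> = h k)
      = pmf (pmf_of_multiset (urn r' b' d h n)) c'" .
qed

lemma polya_urn_after_Red:
  assumes "polya_urn r b d M C" and "0 < r"
  shows "polya_urn (r + d) b d (after M C Red) (\<lambda>n. C (Suc n))"
  using assms by (intro polya_urn_after) (auto simp: prob_first_draw urn_Suc(1) simp del: urn.simps)

lemma polya_urn_after_Black:
  assumes "polya_urn r b d M C" and "0 < r" and "0 < b"
  shows "polya_urn r (b + d) d (after M C Black) (\<lambda>n. C (Suc n))"
  using assms by (intro polya_urn_after) (auto simp: prob_first_draw urn_Suc(2) simp del: urn.simps)

text \<open>
  The form in which the Markov property is used throughout: an event of the whole path is a mixture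
  of events of the path after the first draw, which belongs to an urn with other initial numbers.
\<close>
lemma first_draw:
  assumes urn: "polya_urn r b d M C" and rb: "0 < r" "0 < b"
    and m [measurable]: "Measurable.pred M \<phi>" "Measurable.pred M \<rho>" "Measurable.pred M \<beta>"
    and red: "\<And>\<omega>. \<omega> \<in> space M \<Longrightarrow> C 0 \<omega> = Red \<Longrightarrow> \<phi> \<omega> = \<rho> \<omega>"
    and black: "\<And>\<omega>. \<omega> \<in> space M \<Longrightarrow> C 0 \<omega> = Black \<Longrightarrow> \<phi> \<omega> = \<beta> \<omega>"
  shows "\<P>(\<omega> in M. \<phi> \<omega>) = real r / real (r + b) * \<P>(\<omega> in after M C Red. \<rho> \<omega>)
    + real b / real (r + b) * \<P>(\<omega> in after M C Black. \<beta> \<omega>)"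
proof -
  interpret prob_space M using assms by (simp add: polya_urnD)
  have [measurable]: "\<And>n. C n \<in> M \<rightarrow>\<^sub>M count_space UNIV" using assms by (simp add: polya_urnD)
  have pos: "\<P>(\<omega> in M. C 0 \<omega> = c) > 0" for c
    using rb by (cases c) (simp_all add: prob_first_draw[OF urn])
  have "\<P>(\<omega> in M. \<phi> \<omega>) = \<P>(\<omega> in M. C 0 \<omega> = Red \<and> \<rho> \<omega>) + \<P>(\<omega> in M. C 0 \<omega> = Black \<and> \<beta> \<omega>)"
    using red black
    by (subst finite_measure_Union[symmetric])
       (auto intro!: arg_cong[where f = "measure M"] intro: colour.exhaust)
  also have "\<P>(\<omega> in M. C 0 \<omega> = Red \<and> \<rho> \<omega>)
      = \<P>(\<omega> in M. C 0 \<omega> = Red) * \<P>(\<omega> in after M C Red. \<rho> \<omega>)"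
    using pos[of Red] by (subst prob_after[OF urn _ pos]) auto
  also have "\<P>(\<omega> in M. C 0 \<omega> = Black \<and> \<beta> \<omega>)
      = \<P>(\<omega> in M. C 0 \<omega> = Black) * \<P>(\<omega> in after M C Black. \<beta> \<omega>)"
    using pos[of Black] by (subst prob_after[OF urn _ pos]) auto
  finally show ?thesis
    by (simp only: prob_first_draw[OF urn rb(1)])
qed

section \<open>The path of the proportion\<close>

lemma R_Suc_last: "R r b d C (Suc n) \<omega> = R r b d C n \<omega> + (if C n \<omega> = Red then d else 0)"
  by (simp add: R_def)

lemma R_0 [simp]: "R r b d C 0 \<omega> = r"
  by (simp add: R_def)

lemma Z_0 [simp]: "Z r b d C 0 \<omega> = real r / real (r + b)"
  by (simp add: Z_def)

lemma R_Suc: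
  "C 0 \<omega> = Red \<Longrightarrow> R r b d C (Suc n) \<omega> = R (r + d) b d (\<lambda>n. C (Suc n)) n \<omega>"
  "C 0 \<omega> = Black \<Longrightarrow> R r b d C (Suc n) \<omega> = R r (b + d) d (\<lambda>n. C (Suc n)) n \<omega>"
  unfolding R_def by (simp_all only: urn_Suc)

lemma Z_Suc:
  "C 0 \<omega> = Red \<Longrightarrow> Z r b d C (Suc n) \<omega> = Z (r + d) b d (\<lambda>n. C (Suc n)) n \<omega>"
  "C 0 \<omega> = Black \<Longrightarrow> Z r b d C (Suc n) \<omega> = Z r (b + d) d (\<lambda>n. C (Suc n)) n \<omega>"
  unfolding Z_def by (simp_all only: R_Suc) (simp_all add: algebra_simps)

lemma R_eq: "\<exists>i\<le>n. R r b d C n \<omega> = r + i * d"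
proof (induction n)
  case (Suc n)
  then obtain i where "i \<le> n" "R r b d C n \<omega> = r + i * d" by blast
  then show ?case
    by (cases "C n \<omega> = Red") (auto simp: R_Suc_last intro: exI[of _ i] exI[of _ "Suc i"])
qed simp

lemma Z_eq_q: "\<exists>i\<le>n. Z r b d C n \<omega> = q r b d i n"
  using R_eq[of n r b d C \<omega>] unfolding Z_def q_def by (auto simp: algebra_simps)

lemma bdd_above_Z: "bdd_above ((\<lambda>n. Z r b d C n \<omega>) ` A)"
  using Z_bounds[of r b d C] by (intro bdd_aboveI2[where M = 1]) auto

lemma Z_le_S_sup: "Z r b d C n \<omega> \<le> S_sup r b d C \<omega>"
  unfolding S_sup_def by (intro cSUP_upper bdd_above_Z) simp

lemma M_sup_eq_S_sup:
  "C 0 \<omega> = Red \<Longrightarrow> M_sup r b d C \<omega> = S_sup (r + d) b d (\<lambda>n. C (Suc n)) \<omega>"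
  "C 0 \<omega> = Black \<Longrightarrow> M_sup r b d C \<omega> = S_sup r (b + d) d (\<lambda>n. C (Suc n)) \<omega>"
proof -
  have "(\<lambda>n. Z r b d C n \<omega>) ` {1..} = range (\<lambda>n. Z r b d C (Suc n) \<omega>)"
    by (auto simp: image_iff Bex_def) (metis Suc_le_D One_nat_def)
  then show "C 0 \<omega> = Red \<Longrightarrow> M_sup r b d C \<omega> = S_sup (r + d) b d (\<lambda>n. C (Suc n)) \<omega>"
    "C 0 \<omega> = Black \<Longrightarrow> M_sup r b d C \<omega> = S_sup r (b + d) d (\<lambda>n. C (Suc n)) \<omega>"
    by (simp_all add: M_sup_def S_sup_def Z_Suc)
qed

lemma S_sup_eq_max: "S_sup r b d C \<omega> = max (real r / real (r + b)) (M_sup r b d C \<omega>)"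
proof -
  have "UNIV = insert (0::nat) {1..}" by auto
  then have "S_sup r b d C \<omega> = (SUP n\<in>insert 0 {1..}. Z r b d C n \<omega>)"
    by (simp add: S_sup_def)
  also have "\<dots> = max (Z r b d C 0 \<omega>) (M_sup r b d C \<omega>)"
    unfolding M_sup_def by (subst cSUP_insert) (auto simp: bdd_above_Z sup_max)
  finally show ?thesis by simp
qed

context
  fixes M :: "'a measure" and C :: "nat \<Rightarrow> 'a \<Rightarrow> colour"
  assumes C [measurable]: "\<And>n. C n \<in> M \<rightarrow>\<^sub>M count_space UNIV"
begin

lemma measurable_R: "R r b d C n \<in> M \<rightarrow>\<^sub>M count_space UNIV"
proof (induction n)
  case 0
  then show ?case by (simp add: R_0[abs_def] cong: measurable_cong)
next
  case (Suc n)
  note [measurable] = Suc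
  show ?case
    by (subst measurable_cong[OF R_Suc_last]) measurable
qed

lemma measurable_Z: "Z r b d C n \<in> borel_measurable M"
proof -
  note [measurable] = measurable_R
  show ?thesis unfolding Z_def by measurable
qed

lemma measurable_S_sup: "S_sup r b d C \<in> borel_measurable M"
proof -
  note [measurable] = measurable_Z
  show ?thesis unfolding S_sup_def by (intro borel_measurable_cSUP bdd_above_Z) auto
qed

lemma measurable_M_sup: "M_sup r b d C \<in> borel_measurable M"
proof -
  note [measurable] = measurable_Z
  show ?thesis unfolding M_sup_def by (intro borel_measurable_cSUP bdd_above_Z) auto
qed

end

lemmas [measurable (raw)] = measurable_R measurable_Z measurable_S_sup measurable_M_sup

section \<open>Maximal inequalities\<close>

lemma measurable_pred_R:
  assumes "\<And>n. C n \<in> M \<rightarrow>\<^sub>M count_space UNIV"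
  shows "Measurable.pred M (\<lambda>\<omega>. P (R r b d C n \<omega>))"
  by (rule measurable_compose[OF measurable_R]) (use assms in auto)

lemma ex_le_Suc_iff: "(\<exists>n\<le>Suc m. P n) \<longleftrightarrow> P 0 \<or> (\<exists>n\<le>m. P (Suc n))"
  by (metis Suc_le_mono le0 not0_implies_Suc)

text \<open>
  Ville's inequality for a nonnegative function \<open>f\<close> of the number of red balls and the
  total number of balls which does not increase on average in one draw. Splitting off the first
  draw replaces the usual stopping argument: either the level is reached at once and the right-hand
  side is at least 1, or the bound is averaged over the two urns after the first draw.
\<close>
lemma maximal_inequality_finite:
  fixes f :: "nat \<Rightarrow> nat \<Rightarrow> real"
  assumes nonneg: "\<And>r N. 0 \<le> f r N"
    and super: "\<And>r b. 0 < r \<Longrightarrow> 0 < b \<Longrightarrow> real r / real (r + b) * f (r + d) (r + b + d)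
      + real b / real (r + b) * f r (r + b + d) \<le> f r (r + b)"
    and l: "0 < l"
    and "polya_urn r b d M C" and "0 < r" and "0 < b"
  shows "\<P>(\<omega> in M. \<exists>n\<le>m. l \<le> f (R r b d C n \<omega>) (n * d + r + b)) \<le> f r (r + b) / l"
  using assms(4-6)
proof (induction m arbitrary: r b M C)
  case (0 r b M C)
  interpret prob_space M using 0 by (simp add: polya_urnD)
  show ?case
    using nonneg[of r "r + b"] l by (cases "l \<le> f r (r + b)") (auto simp: prob_space)
next
  case (Suc m r b M C)
  interpret prob_space M using Suc.prems by (simp add: polya_urnD)
  note [measurable] = polya_urnD(2)[OF Suc.prems(1)]
  let ?A = "\<lambda>r b C \<omega>. \<exists>n\<le>m. l \<le> f (R r b d C n \<omega>) (n * d + r + b)"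
  show ?case
  proof (cases "l \<le> f r (r + b)")
    case True
    then show ?thesis using l by (intro order.trans[OF prob_le_1]) simp
  next
    case False
    have [measurable]: "Measurable.pred M (\<lambda>\<omega>. l \<le> f (R r b d C' n \<omega>) k)"
      if "\<And>n. C' n \<in> M \<rightarrow>\<^sub>M count_space UNIV" for r b C' n k
      using that by (rule measurable_pred_R)
    have "\<P>(\<omega> in M. \<exists>n\<le>Suc m. l \<le> f (R r b d C n \<omega>) (n * d + r + b))
        = real r / real (r + b) * \<P>(\<omega> in after M C Red. ?A (r + d) b (\<lambda>n. C (Suc n)) \<omega>)
        + real b / real (r + b) * \<P>(\<omega> in after M C Black. ?A r (b + d) (\<lambda>n. C (Suc n)) \<omega>)"
      using False
      by (intro first_draw[OF Suc.prems])
         (auto simp: ex_le_Suc_iff R_Suc algebra_simps)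
    also have "\<dots> \<le> real r / real (r + b) * (f (r + d) (r + d + b) / l)
        + real b / real (r + b) * (f r (r + (b + d)) / l)"
      using Suc.prems
      by (intro add_mono mult_left_mono Suc.IH polya_urn_after_Red polya_urn_after_Black) auto
    also have "\<dots> = (real r / real (r + b) * f (r + d) (r + b + d)
        + real b / real (r + b) * f r (r + b + d)) / l"
      by (simp add: add_divide_distrib ac_simps)
    also have "\<dots> \<le> f r (r + b) / l"
      using super[OF Suc.prems(2,3)] l by (simp add: divide_right_mono)
    finally show ?thesis .
  qed
qed

lemma maximal_inequality:
  fixes f :: "nat \<Rightarrow> nat \<Rightarrow> real"
  assumes nonneg: "\<And>r N. 0 \<le> f r N"
    and super: "\<And>r b. 0 < r \<Longrightarrow> 0 < b \<Longrightarrow> real r / real (r + b) * f (r + d) (r + b + d)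
      + real b / real (r + b) * f r (r + b + d) \<le> f r (r + b)"
    and l: "0 < l"
    and urn: "polya_urn r b d M C" and rb: "0 < r" "0 < b"
  shows "\<P>(\<omega> in M. \<exists>n. l \<le> f (R r b d C n \<omega>) (n * d + r + b)) \<le> f r (r + b) / l"
proof -
  interpret prob_space M using urn by (simp add: polya_urnD)
  let ?B = "\<lambda>m. {\<omega> \<in> space M. \<exists>n\<le>m. l \<le> f (R r b d C n \<omega>) (n * d + r + b)}"
  have [measurable]: "Measurable.pred M (\<lambda>\<omega>. l \<le> f (R r b d C n \<omega>) k)" for n k
    using polya_urnD(2)[OF urn] by (rule measurable_pred_R)
  have "range ?B \<subseteq> sets M" by auto
  moreover have "incseq ?B" by (auto simp: incseq_def) (meson le_trans)
  ultimately have "(\<lambda>m. prob (?B m)) \<longlonglongrightarrow> prob (\<Union>m. ?B m)"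
    by (rule finite_Lim_measure_incseq)
  moreover have "(\<Union>m. ?B m) = {\<omega> \<in> space M. \<exists>n. l \<le> f (R r b d C n \<omega>) (n * d + r + b)}"
    by auto
  ultimately show ?thesis
    using maximal_inequality_finite[OF assms] by (auto intro: LIMSEQ_le_const2)
qed

lemma prob_proportion_reaches:
  assumes "polya_urn r b d M C" and "0 < r" and "0 < b" and "0 < x"
  shows "\<P>(\<omega> in M. \<exists>n. x \<le> Z r b d C n \<omega>) \<le> real r / real (r + b) / x"
  unfolding Z_def
proof (rule maximal_inequality[where f = "\<lambda>r N. real r / real N", OF _ _ assms(4,1-3)])
  fix r b :: nat assume "0 < r" "0 < b"
  define N where "N = real r + real b"
  have "real r / N * ((r + d) / (N + d)) + b / N * (r / (N + d)) = r * (N + d) / (N * (N + d))"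
    by (simp only: times_divide_times_eq add_divide_distrib[symmetric]) (simp add: N_def algebra_simps)
  also have "\<dots> = r / N"
    using \<open>0 < r\<close> by (simp add: N_def)
  finally show "real r / real (r + b) * (real (r + d) / real (r + b + d))
      + real b / real (r + b) * (real r / real (r + b + d)) \<le> real r / real (r + b)"
    by (simp add: N_def)
qed simp

text \<open>
  A draw from an urn with \<open>N\<close> balls increases the mean of \<open>(Z - a)\<^sup>2\<close> by at most
  \<open>(d / (N + d))\<^sup>2\<close>. This is less than \<open>d / N - d / (N + d)\<close>, so
  \<open>(Z - a)\<^sup>2 + d / N\<close> does not increase on average.
\<close>
lemma prob_proportion_leaves:
  assumes urn: "polya_urn r b d M C" and rb: "0 < r" "0 < b" and "0 < e"
  shows "\<P>(\<omega> in M. \<exists>n. e \<le> \<bar>Z r b d C n \<omega> - real r / real (r + b)\<bar>)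
    \<le> real d / (real (r + b) * e\<^sup>2)"
proof -
  interpret prob_space M using urn by (simp add: polya_urnD)
  note [measurable] = polya_urnD(2)[OF urn]
  define a where "a = real r / real (r + b)"
  define f where "f r N = (real r / real N - a)\<^sup>2 + real d / real N" for r N
  have "\<P>(\<omega> in M. \<exists>n. e \<le> \<bar>Z r b d C n \<omega> - a\<bar>)
      \<le> \<P>(\<omega> in M. \<exists>n. e\<^sup>2 \<le> f (R r b d C n \<omega>) (n * d + r + b))"
  proof (intro finite_measure_mono)
    have "e\<^sup>2 \<le> f (R r b d C n \<omega>) (n * d + r + b)" if "e \<le> \<bar>Z r b d C n \<omega> - a\<bar>" for n \<omega>
    proof -
      have "e\<^sup>2 \<le> \<bar>Z r b d C n \<omega> - a\<bar>\<^sup>2"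
        using that \<open>0 < e\<close> by (intro power_mono) auto
      also have "\<dots> \<le> f (R r b d C n \<omega>) (n * d + r + b)"
        by (simp add: f_def Z_def)
      finally show ?thesis .
    qed
    then show "{\<omega> \<in> space M. \<exists>n. e \<le> \<bar>Z r b d C n \<omega> - a\<bar>}
        \<subseteq> {\<omega> \<in> space M. \<exists>n. e\<^sup>2 \<le> f (R r b d C n \<omega>) (n * d + r + b)}" by blast
    have [measurable]: "Measurable.pred M (\<lambda>\<omega>. e\<^sup>2 \<le> f (R r b d C n \<omega>) k)" for n k
      using polya_urnD(2)[OF urn] by (rule measurable_pred_R)
    show "{\<omega> \<in> space M. \<exists>n. e\<^sup>2 \<le> f (R r b d C n \<omega>) (n * d + r + b)} \<in> sets M"
      by measurable
  qed
  also have "\<dots> \<le> f r (r + b) / e\<^sup>2"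
  proof (rule maximal_inequality[OF _ _ _ urn rb])
    fix r b :: nat assume rb: "0 < r" "0 < b"
    \<comment> \<open>In one draw the proportion \<open>z\<close> moves to a convex combination, with weight \<open>t\<close>,
      of \<open>z\<close> and of 1 (red) or 0 (black).\<close>
    define z t where "z = real r / real (r + b)" and "t = real d / real (r + b + d)"
    have t: "0 \<le> t" "t < 1" and z: "0 \<le> z" "z \<le> 1"
      using rb by (auto simp: t_def z_def)
    have zb: "real b / real (r + b) = 1 - z"
      and tN: "real d / real (r + b) = t / (1 - t)"
      and up: "real (r + d) / real (r + b + d) = (1 - t) * z + t"
      and down: "real r / real (r + b + d) = (1 - t) * z"
      using rb by (simp_all add: z_def t_def divide_simps)
    have "t * (1 + t) * (1 - t) \<le> t"
    proof -
      have "t * (1 + t) * (1 - t) = t - t * t\<^sup>2" by (simp add: algebra_simps power2_eq_square)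
      then show ?thesis using t by simp
    qed
    then have drift: "t + t\<^sup>2 \<le> t / (1 - t)"
      using t by (simp add: le_divide_eq algebra_simps power2_eq_square)
    have "z * (1 - z) \<le> 1 * 1" using z by (intro mult_mono) auto
    then have "t\<^sup>2 * (z * (1 - z)) \<le> t\<^sup>2" by (simp add: mult_left_le)
    then have "z * (((1 - t) * z + t - a)\<^sup>2 + t) + (1 - z) * (((1 - t) * z - a)\<^sup>2 + t)
        \<le> (z - a)\<^sup>2 + (t + t\<^sup>2)"
      by (simp add: algebra_simps power2_eq_square)
    also have "\<dots> \<le> (z - a)\<^sup>2 + t / (1 - t)"
      using drift by simp
    finally show "real r / real (r + b) * f (r + d) (r + b + d)
        + real b / real (r + b) * f r (r + b + d) \<le> f r (r + b)"
      unfolding f_def up down zb tN by (simp add: z_def t_def)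
  qed (use \<open>0 < e\<close> in \<open>auto simp: f_def\<close>)
  also have "f r (r + b) / e\<^sup>2 = real d / (real (r + b) * e\<^sup>2)"
    by (simp add: f_def a_def)
  finally show ?thesis unfolding a_def .
qed

section \<open>Spread of the number of red balls\<close>

lemma R_bounds: "r \<le> R r b d C n \<omega>" "R r b d C n \<omega> \<le> r + n * d"
  using R_eq[of n r b d C \<omega>] by auto

lemma prob_R_draw_Red:
  assumes "polya_urn r b d M C" and "0 < r" and "0 < b"
  shows "\<P>(\<omega> in M. R r b d C n \<omega> = k \<and> C n \<omega> = Red)
    = real k / real (n * d + r + b) * \<P>(\<omega> in M. R r b d C n \<omega> = k)"
  using assms
proof (induction n arbitrary: r b M C)
  case (0 r b M C)
  interpret prob_space M using 0 by (simp add: polya_urnD)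
  show ?case
    by (cases "k = r") (auto simp: prob_first_draw[OF 0(1,2)] prob_space)
next
  case (Suc n r b M C)
  note [measurable] = polya_urnD(2)[OF Suc.prems(1)]
  have [measurable]: "Measurable.pred M (\<lambda>\<omega>. R r b d C' n \<omega> = k)"
    if "\<And>n. C' n \<in> M \<rightarrow>\<^sub>M count_space UNIV" for r b C' n k
    using that by (rule measurable_pred_R)
  let ?C = "\<lambda>n. C (Suc n)"
  have "\<P>(\<omega> in M. R r b d C (Suc n) \<omega> = k \<and> C (Suc n) \<omega> = Red)
      = real r / real (r + b) * \<P>(\<omega> in after M C Red. R (r + d) b d ?C n \<omega> = k \<and> ?C n \<omega> = Red)
      + real b / real (r + b) * \<P>(\<omega> in after M C Black. R r (b + d) d ?C n \<omega> = k \<and> ?C n \<omega> = Red)"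
    by (rule first_draw[OF Suc.prems]) (auto simp: R_Suc)
  also have "\<dots> = real k / real (Suc n * d + r + b) *
      (real r / real (r + b) * \<P>(\<omega> in after M C Red. R (r + d) b d ?C n \<omega> = k)
      + real b / real (r + b) * \<P>(\<omega> in after M C Black. R r (b + d) d ?C n \<omega> = k))"
    using Suc.IH[OF polya_urn_after_Red[OF Suc.prems(1,2)]] Suc.IH[OF polya_urn_after_Black[OF Suc.prems]]
      Suc.prems(2,3)
    by (simp add: algebra_simps)
  also have "real r / real (r + b) * \<P>(\<omega> in after M C Red. R (r + d) b d ?C n \<omega> = k)
      + real b / real (r + b) * \<P>(\<omega> in after M C Black. R r (b + d) d ?C n \<omega> = k)
      = \<P>(\<omega> in M. R r b d C (Suc n) \<omega> = k)"
    by (rule first_draw[OF Suc.prems, symmetric]) (auto simp: R_Suc)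
  finally show ?case .
qed

lemma prob_R_draw_Black:
  assumes urn: "polya_urn r b d M C" and rb: "0 < r" "0 < b"
  shows "\<P>(\<omega> in M. R r b d C n \<omega> = k \<and> C n \<omega> = Black)
    = (1 - real k / real (n * d + r + b)) * \<P>(\<omega> in M. R r b d C n \<omega> = k)"
proof -
  interpret prob_space M using urn by (simp add: polya_urnD)
  note [measurable] = polya_urnD(2)[OF urn]
  have [measurable]: "Measurable.pred M (\<lambda>\<omega>. R r b d C n \<omega> = k)"
    using polya_urnD(2)[OF urn] by (rule measurable_pred_R)
  have "\<P>(\<omega> in M. R r b d C n \<omega> = k)
      = \<P>(\<omega> in M. R r b d C n \<omega> = k \<and> C n \<omega> = Red) + \<P>(\<omega> in M. R r b d C n \<omega> = k \<and> C n \<omega> = Black)"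
    by (subst finite_measure_Union[symmetric])
       (auto intro!: arg_cong[where f = "measure M"] intro: colour.exhaust)
  then show ?thesis
    using prob_R_draw_Red[OF assms, of n k] by (simp add: algebra_simps)
qed

text \<open>
  With \<open>N\<close> balls in the urn, the next number of red balls is \<open>k\<close> either by a red draw
  from \<open>k - d\<close>, with probability \<open>(k - d) / N\<close>, or by a black draw from \<open>k\<close>,
  with probability \<open>1 - k / N\<close>. These factors add up to \<open>1 - d / N\<close>, so the largest point mass
  decays like the inverse of the number of balls. The factors are nonnegative in the relevant
  range of \<open>k\<close> because \<open>r\<close> and \<open>b\<close> are at least \<open>d\<close>; for a smaller \<open>r\<close> or
  \<open>b\<close> the extreme masses decay more slowly and the bound fails.
\<close>
lemma prob_R_le:
  assumes urn: "polya_urn r b d M C" and d: "0 < d" "d \<le> r" "d \<le> b"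
  shows "\<P>(\<omega> in M. R r b d C n \<omega> = k) \<le> real (r + b) / real (r + b + n * d)"
proof (induction n arbitrary: k)
  case 0
  interpret prob_space M using urn by (simp add: polya_urnD)
  show ?case using d by simp
next
  case (Suc n)
  interpret prob_space M using urn by (simp add: polya_urnD)
  note [measurable] = polya_urnD(2)[OF urn]
  have [measurable]: "Measurable.pred M (\<lambda>\<omega>. R r b d C n \<omega> = k)" for n k
    using polya_urnD(2)[OF urn] by (rule measurable_pred_R)
  have rb: "0 < r" "0 < b" using d by auto
  define N where "N = real (n * d + r + b)"
  have N: "0 < N" using rb by (simp only: N_def of_nat_0_less_iff)
  show ?case
  proof (cases "d \<le> k \<and> k \<le> n * d + r + b")
    case True
    let ?p = "\<lambda>k. \<P>(\<omega> in M. R r b d C n \<omega> = k)"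
    have "\<P>(\<omega> in M. R r b d C (Suc n) \<omega> = k)
        = \<P>(\<omega> in M. R r b d C n \<omega> = k - d \<and> C n \<omega> = Red) + \<P>(\<omega> in M. R r b d C n \<omega> = k \<and> C n \<omega> = Black)"
      using True
      by (subst finite_measure_Union[symmetric])
         (auto intro!: arg_cong[where f = "measure M"] intro: colour.exhaust simp: R_Suc_last)
    also have "\<dots> = real (k - d) / N * ?p (k - d) + (1 - real k / N) * ?p k"
      by (simp add: prob_R_draw_Red[OF urn rb] prob_R_draw_Black[OF urn rb] N_def)
    also have "\<dots> \<le> real (k - d) / N * (real (r + b) / N) + (1 - real k / N) * (real (r + b) / N)"
      using Suc.IH[of "k - d"] Suc.IH[of k] True N
      by (intro add_mono mult_left_mono) (auto simp: N_def ac_simps simp del: of_nat_add of_nat_mult)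
    also have "\<dots> = (N - d) / N\<^sup>2 * real (r + b)"
      using True N by (simp add: field_simps power2_eq_square of_nat_diff)
    also have "\<dots> \<le> 1 / (N + d) * real (r + b)"
    proof (intro mult_right_mono)
      have "(N - d) * (N + d) \<le> N\<^sup>2" by (simp add: algebra_simps power2_eq_square)
      then show "(N - d) / N\<^sup>2 \<le> 1 / (N + d)"
        using N by (simp add: divide_simps add_pos_nonneg)
    qed simp
    also have "\<dots> = real (r + b) / real (r + b + Suc n * d)"
      by (simp add: N_def algebra_simps)
    finally show ?thesis .
  next
    case False
    have "R r b d C (Suc n) \<omega> \<noteq> k" for \<omega>
      using False d R_bounds[of r b d C "Suc n" \<omega>] by auto
    then show ?thesis by simp
  qed
qed

lemma card_near_le:
  fixes N x e :: real
  assumes "0 < N" and "0 < e"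
  shows "finite {k::nat. \<bar>real k / N - x\<bar> < e}"
    and "real (card {k::nat. \<bar>real k / N - x\<bar> < e}) \<le> 2 * e * N + 1"
proof -
  let ?K = "{k::nat. \<bar>real k / N - x\<bar> < e}"
  let ?J = "{\<lceil>N * (x - e)\<rceil>..\<lfloor>N * (x + e)\<rfloor>}"
  have "int k \<in> ?J" if "k \<in> ?K" for k
    using that assms by (auto simp: ceiling_le_iff le_floor_iff abs_less_iff field_simps)
  then have sub: "int ` ?K \<subseteq> ?J" by blast
  then show fin: "finite ?K"
    by (meson finite_atLeastAtMost_int finite_imageD finite_subset inj_on_of_nat)
  have "card ?K = card (int ` ?K)" by (simp add: card_image)
  also have "\<dots> \<le> card ?J" using sub by (intro card_mono) auto
  finally have "real (card ?K) \<le> real (nat (\<lfloor>N * (x + e)\<rfloor> - \<lceil>N * (x - e)\<rceil> + 1))" by simp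
  also have "\<dots> \<le> 2 * e * N + 1"
  proof (cases "0 \<le> \<lfloor>N * (x + e)\<rfloor> - \<lceil>N * (x - e)\<rceil> + 1")
    case True
    then have "real (nat (\<lfloor>N * (x + e)\<rfloor> - \<lceil>N * (x - e)\<rceil> + 1))
        = of_int \<lfloor>N * (x + e)\<rfloor> - of_int \<lceil>N * (x - e)\<rceil> + 1" by simp
    also have "\<dots> \<le> N * (x + e) - N * (x - e) + 1"
      using of_int_floor_le[of "N * (x + e)"] le_of_int_ceiling[of "N * (x - e)"] by linarith
    finally show ?thesis by (simp add: algebra_simps)
  qed (use assms in simp)
  finally show "real (card ?K) \<le> 2 * e * N + 1" .
qed

lemma prob_proportion_near_le:
  assumes urn: "polya_urn r b d M C" and d: "0 < d" "d \<le> r" "d \<le> b" and e: "0 < e"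
  shows "\<P>(\<omega> in M. \<bar>Z r b d C n \<omega> - x\<bar> < e) \<le> real (r + b) * (2 * e + 1 / real (r + b + n * d))"
proof -
  interpret prob_space M using urn by (simp add: polya_urnD)
  have [measurable]: "Measurable.pred M (\<lambda>\<omega>. R r b d C n \<omega> = k)" for n k
    using polya_urnD(2)[OF urn] by (rule measurable_pred_R)
  define N where "N = real (n * d + r + b)"
  have N: "0 < N" using d by (simp only: N_def of_nat_0_less_iff)
  let ?K = "{k::nat. \<bar>real k / N - x\<bar> < e}"
  have "\<P>(\<omega> in M. \<bar>Z r b d C n \<omega> - x\<bar> < e) = prob (\<Union>k\<in>?K. {\<omega> \<in> space M. R r b d C n \<omega> = k})"
    by (intro arg_cong[where f = prob]) (auto simp: Z_def N_def)
  also have "\<dots> \<le> (\<Sum>k\<in>?K. \<P>(\<omega> in M. R r b d C n \<omega> = k))"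
    using card_near_le[OF N e] by (intro finite_measure_subadditive_finite) auto
  also have "\<dots> \<le> real (card ?K) * (real (r + b) / N)"
    using prob_R_le[OF urn d, of n] by (intro sum_bounded_above) (simp add: N_def ac_simps)
  also have "\<dots> \<le> (2 * e * N + 1) * (real (r + b) / N)"
    using card_near_le[OF N e] N by (intro mult_right_mono) auto
  also have "\<dots> = real (r + b) * (2 * e + 1 / N)"
    using N by (simp add: field_simps)
  finally show ?thesis by (simp add: N_def ac_simps)
qed

section \<open>The supremum is attained\<close>

text \<open>
  The bound of \<open>prob_proportion_leaves\<close> depends on the number of balls only, so it holds
  uniformly over the possible contents of the urn after \<open>N\<close> draws.
\<close>
lemma prob_unsettled_le:
  assumes "polya_urn r b d M C" and "0 < r" and "0 < b" and e: "0 < e"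
  shows "\<P>(\<omega> in M. \<exists>n\<ge>N. e \<le> \<bar>Z r b d C n \<omega> - Z r b d C N \<omega>\<bar>)
    \<le> real d / (real (r + b + N * d) * e\<^sup>2)"
  using assms(1-3)
proof (induction N arbitrary: r b M C)
  case (0 r b M C)
  then show ?case using prob_proportion_leaves[OF 0 e] by simp
next
  case (Suc N r b M C)
  note [measurable] = polya_urnD(2)[OF Suc.prems(1)]
  let ?A = "\<lambda>r b C \<omega>. \<exists>n\<ge>N. e \<le> \<bar>Z r b d C n \<omega> - Z r b d C N \<omega>\<bar>"
  let ?D = "real d / (real (r + b + Suc N * d) * e\<^sup>2)"
  have "\<P>(\<omega> in M. \<exists>n\<ge>Suc N. e \<le> \<bar>Z r b d C n \<omega> - Z r b d C (Suc N) \<omega>\<bar>)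
      = real r / real (r + b) * \<P>(\<omega> in after M C Red. ?A (r + d) b (\<lambda>n. C (Suc n)) \<omega>)
      + real b / real (r + b) * \<P>(\<omega> in after M C Black. ?A r (b + d) (\<lambda>n. C (Suc n)) \<omega>)"
  proof (rule first_draw[OF Suc.prems])
    have shift: "(\<exists>n\<ge>Suc N. P n) \<longleftrightarrow> (\<exists>n\<ge>N. P (Suc n))" for P
      by (metis Suc_le_D Suc_le_mono)
    show "C 0 \<omega> = Red \<Longrightarrow> (\<exists>n\<ge>Suc N. e \<le> \<bar>Z r b d C n \<omega> - Z r b d C (Suc N) \<omega>\<bar>)
        = ?A (r + d) b (\<lambda>n. C (Suc n)) \<omega>" for \<omega>
      unfolding shift by (simp add: Z_Suc)
    show "C 0 \<omega> = Black \<Longrightarrow> (\<exists>n\<ge>Suc N. e \<le> \<bar>Z r b d C n \<omega> - Z r b d C (Suc N) \<omega>\<bar>)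
        = ?A r (b + d) (\<lambda>n. C (Suc n)) \<omega>" for \<omega>
      unfolding shift by (simp add: Z_Suc)
  qed measurable
  also have "\<dots> \<le> real r / real (r + b) * ?D + real b / real (r + b) * ?D"
    using Suc.IH[OF polya_urn_after_Red[OF Suc.prems(1,2)]] Suc.IH[OF polya_urn_after_Black[OF Suc.prems]]
      Suc.prems(2,3)
    by (intro add_mono mult_left_mono) (simp_all add: ac_simps)
  also have "\<dots> = ?D"
    using Suc.prems(2) by (simp only: distrib_right[symmetric] add_divide_distrib[symmetric]) simp
  finally show ?case .
qed

definition unattained where
  "unattained r b d C x \<omega> \<longleftrightarrow> S_sup r b d C \<omega> = x \<and> (\<forall>n. Z r b d C n \<omega> \<noteq> x)"

lemma measurable_unattained:
  assumes [measurable]: "\<And>n. C n \<in> M \<rightarrow>\<^sub>M count_space UNIV"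
  shows "Measurable.pred M (unattained r b d C x)"
  unfolding unattained_def by measurable

lemma unattained_Suc:
  assumes "unattained r b d C x \<omega>"
  shows "C 0 \<omega> = Red \<Longrightarrow> unattained (r + d) b d (\<lambda>n. C (Suc n)) x \<omega>"
    and "C 0 \<omega> = Black \<Longrightarrow> unattained r (b + d) d (\<lambda>n. C (Suc n)) x \<omega>"
proof -
  have "real r / real (r + b) \<noteq> x" using assms Z_0 unattained_def by metis
  then have "M_sup r b d C \<omega> = x"
    using assms by (auto simp: unattained_def S_sup_eq_max max_def split: if_splits)
  then show "C 0 \<omega> = Red \<Longrightarrow> unattained (r + d) b d (\<lambda>n. C (Suc n)) x \<omega>"
    and "C 0 \<omega> = Black \<Longrightarrow> unattained r (b + d) d (\<lambda>n. C (Suc n)) x \<omega>"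
    using assms by (simp_all add: unattained_def M_sup_eq_S_sup flip: Z_Suc)
qed

text \<open>
  Each of the first \<open>N\<close> values is strictly below the supremum, so a value closer to the
  supremum than all of them occurs later.
\<close>
lemma unattained_approached:
  assumes "unattained r b d C x \<omega>" and "0 < e"
  shows "\<exists>n\<ge>N. x - e < Z r b d C n \<omega>"
  using assms(2)
proof (induction N arbitrary: e)
  case 0
  then have "x - e < (SUP n. Z r b d C n \<omega>)"
    using assms(1) by (simp add: unattained_def S_sup_def)
  then show ?case by (subst (asm) less_cSUP_iff) (auto simp: bdd_above_Z)
next
  case (Suc N)
  have "Z r b d C N \<omega> < x"
    using assms(1) Z_le_S_sup[of r b d C N \<omega>] by (simp add: unattained_def less_le)
  then have "0 < min e (x - Z r b d C N \<omega>)" using Suc.prems by simp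
  from Suc.IH[OF this] obtain n where n: "N \<le> n" "x - min e (x - Z r b d C N \<omega>) < Z r b d C n \<omega>"
    by blast
  then have "n \<noteq> N" by auto
  with n show ?case by (intro exI[of _ n]) auto
qed

lemma prob_unattained_many_balls:
  assumes urn: "polya_urn r b d M C" and d: "0 < d" "d \<le> r" "d \<le> b"
  shows "\<P>(\<omega> in M. unattained r b d C x \<omega>) = 0"
proof -
  interpret prob_space M using urn by (simp add: polya_urnD)
  note [measurable] = polya_urnD(2)[OF urn] measurable_unattained
  have rb: "0 < r" "0 < b" using d by auto
  let ?p = "\<P>(\<omega> in M. unattained r b d C x \<omega>)"
  have bound: "?p \<le> real (r + b) * (4 * e)" if e: "0 < e" for e
  proof -
    define K where "K N = real (r + b + N * d)" for N
    have le: "?p \<le> real (r + b) * (4 * e + 1 / K N) + real d / (K N * e\<^sup>2)" for N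
    proof -
      let ?near = "{\<omega> \<in> space M. \<bar>Z r b d C N \<omega> - x\<bar> < 2 * e}"
      let ?uns = "{\<omega> \<in> space M. \<exists>n\<ge>N. e \<le> \<bar>Z r b d C n \<omega> - Z r b d C N \<omega>\<bar>}"
      have "\<omega> \<in> ?near \<union> ?uns" if \<omega>: "\<omega> \<in> space M" "unattained r b d C x \<omega>" for \<omega>
      proof -
        obtain n where "N \<le> n" "x - e < Z r b d C n \<omega>"
          using unattained_approached[OF \<omega>(2) e] by blast
        moreover have "Z r b d C n \<omega> \<le> x"
          using \<omega>(2) Z_le_S_sup[of r b d C n \<omega>] by (simp add: unattained_def)
        ultimately show ?thesis using \<omega>(1) by (cases "\<omega> \<in> ?uns") force+
      qed
      then have "?p \<le> prob (?near \<union> ?uns)"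
        by (intro finite_measure_mono) auto
      also have "\<dots> \<le> prob ?near + prob ?uns"
        by (intro measure_Un_le) auto
      also have "\<dots> \<le> real (r + b) * (2 * (2 * e) + 1 / K N) + real d / (K N * e\<^sup>2)"
        using prob_proportion_near_le[OF urn d, of "2 * e" N x] prob_unsettled_le[OF urn rb e, of N] e
        by (intro add_mono) (simp_all add: K_def)
      finally show ?thesis by simp
    qed
    have K: "filterlim K at_top sequentially"
      unfolding K_def using d(1) by real_asymp
    have "(\<lambda>N. real (r + b) * (4 * e + 1 / K N) + real d / e\<^sup>2 * (1 / K N))
        \<longlonglongrightarrow> real (r + b) * (4 * e + 0) + real d / e\<^sup>2 * 0"
      by (intro tendsto_intros tendsto_divide_0[OF tendsto_const] filterlim_at_top_imp_at_infinity K)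
    then show ?thesis
      using le by (intro LIMSEQ_le_const) (auto simp: mult.commute)
  qed
  have "((\<lambda>e. real (r + b) * (4 * e)) \<longlongrightarrow> real (r + b) * (4 * 0)) (at_right 0)"
    by (intro tendsto_intros)
  then have "?p \<le> 0"
    using bound by (intro tendsto_lowerbound[where F = "at_right 0"])
      (auto simp: eventually_at_right_less intro: eventually_at_rightI[of 0 1])
  then show ?thesis by (simp add: order_antisym)
qed

text \<open>
  Drawing a colour with \<open>a\<close> balls \<open>n\<close> times in a row has the probability
  \<open>(\<Prod>k<n. (a + k d) / (a + k d + b))\<close>. That this tends to 0 follows from
  Bernoulli's inequality \<open>1 + d / a \<le> (1 + b / a) ^ d\<close>: the \<open>d\<close>th power of
  the product is bounded by the telescoping product \<open>(\<Prod>k<n. (a + k d) / (a + (k + 1) d))\<close>.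
  The lemma is one step of this, in the form needed when \<open>p\<close> and \<open>p'\<close> are the
  probabilities of the same event before and after a draw of this colour.
\<close>
lemma power_decay:
  fixes a b d :: nat and p p' :: real
  assumes d: "0 < d" and ab: "0 < a" "0 < b"
    and p: "0 \<le> p" "p \<le> real a / real (a + b) * p'"
    and p': "p' ^ d \<le> real (a + d) / real (a + d + n * d)"
  shows "p ^ d \<le> real a / real (a + Suc n * d)"
proof -
  define A where "A = real a"
  have A: "0 < A" using ab by (simp add: A_def)
  have "A + d \<le> A * (1 + real d * (b / A))"
    using A ab d by (simp add: algebra_simps)
  also have "\<dots> \<le> A * (1 + b / A) ^ d"
  proof (intro mult_left_mono Bernoulli_inequality)
    show "- 1 \<le> b / A" using A by (simp add: order_trans[of _ 0])
  qed (use A in simp)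
  also have "1 + b / A = (A + b) / A" using A by (simp add: field_simps)
  finally have "A + d \<le> A * ((A + b) / A) ^ d" .
  then have key: "(A / (A + b)) ^ d * (A + d) \<le> A"
    using A by (simp add: power_divide field_simps)
  have "p ^ d \<le> (A / (A + b) * p') ^ d"
    using p by (intro power_mono) (simp_all add: A_def)
  also have "\<dots> = (A / (A + b)) ^ d * p' ^ d" by (rule power_mult_distrib)
  also have "\<dots> \<le> (A / (A + b)) ^ d * ((A + d) / (A + d + n * d))"
    using p' A by (intro mult_left_mono) (simp_all add: A_def)
  also have "\<dots> = ((A / (A + b)) ^ d * (A + d)) / (A + d + n * d)" by simp
  also have "\<dots> \<le> A / (A + d + n * d)"
    using key A by (intro divide_right_mono) auto
  finally show ?thesis by (simp add: A_def algebra_simps)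
qed

lemma power_decay_imp_0:
  fixes a d :: nat and p :: real
  assumes d: "0 < d" and p: "0 \<le> p" "\<And>n. p ^ d \<le> real a / real (a + n * d)"
  shows "p = 0"
proof -
  have "(\<lambda>n. real a / real (a + n * d)) \<longlonglongrightarrow> 0"
    using d by real_asymp
  then have "p ^ d \<le> 0"
    by (rule LIMSEQ_le_const) (use p in auto)
  then show ?thesis using p(1) d by (metis order_antisym zero_le_power power_eq_0_iff)
qed

lemma prob_unattained_le:
  assumes urn: "polya_urn r b d M C" and rb: "0 < r" "0 < b"
  shows "\<P>(\<omega> in M. unattained r b d C x \<omega>)
    \<le> real r / real (r + b) * \<P>(\<omega> in after M C Red. unattained (r + d) b d (\<lambda>n. C (Suc n)) x \<omega>)
      + real b / real (r + b) * \<P>(\<omega> in after M C Black. unattained r (b + d) d (\<lambda>n. C (Suc n)) x \<omega>)"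
proof -
  interpret prob_space M using urn by (simp add: polya_urnD)
  note [measurable] = polya_urnD(2)[OF urn] measurable_unattained
  let ?next = "\<lambda>\<omega>. if C 0 \<omega> = Red then unattained (r + d) b d (\<lambda>n. C (Suc n)) x \<omega>
    else unattained r (b + d) d (\<lambda>n. C (Suc n)) x \<omega>"
  have "?next \<omega>" if "unattained r b d C x \<omega>" for \<omega>
    using unattained_Suc[OF that] by (cases "C 0 \<omega>") auto
  then have "\<P>(\<omega> in M. unattained r b d C x \<omega>) \<le> \<P>(\<omega> in M. ?next \<omega>)"
    by (intro finite_measure_mono) auto
  also have "\<P>(\<omega> in M. ?next \<omega>) = real r / real (r + b) * \<P>(\<omega> in after M C Red. unattained (r + d) b d (\<lambda>n. C (Suc n)) x \<omega>)
      + real b / real (r + b) * \<P>(\<omega> in after M C Black. unattained r (b + d) d (\<lambda>n. C (Suc n)) x \<omega>)"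
    by (rule first_draw[OF assms]) auto
  finally show ?thesis .
qed

text \<open>
  A red draw leads to an urn with at least \<open>d\<close> balls of each colour, where the probability
  is 0. Hence only the paths on which black is drawn forever could contribute.
\<close>
lemma prob_unattained_many_black:
  assumes urn: "polya_urn r b d M C" and "0 < r" and d: "0 < d" "d \<le> b"
  shows "\<P>(\<omega> in M. unattained r b d C x \<omega>) = 0"
proof (rule power_decay_imp_0[OF d(1)])
  show "\<P>(\<omega> in M. unattained r b d C x \<omega>) ^ d \<le> real b / real (b + n * d)" for n
    using urn d(2)
  proof (induction n arbitrary: b M C)
    case (0 b M C)
    interpret prob_space M using 0 by (simp add: polya_urnD)
    show ?case using 0 d(1) by (simp add: power_le_one)
  next
    case (Suc n b M C)
    have b: "0 < b" using d(1) Suc.prems by simp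
    have red: "polya_urn (r + d) b d (after M C Red) (\<lambda>n. C (Suc n))"
      and black: "polya_urn r (b + d) d (after M C Black) (\<lambda>n. C (Suc n))"
      using Suc.prems(1) \<open>0 < r\<close> b by (auto intro: polya_urn_after_Red polya_urn_after_Black)
    show ?case
    proof (rule power_decay[OF d(1) b \<open>0 < r\<close>])
      show "\<P>(\<omega> in M. unattained r b d C x \<omega>) \<le> real b / real (b + r)
          * \<P>(\<omega> in after M C Black. unattained r (b + d) d (\<lambda>n. C (Suc n)) x \<omega>)"
        using prob_unattained_le[OF Suc.prems(1) \<open>0 < r\<close> b, of x]
          prob_unattained_many_balls[OF red d(1) _ Suc.prems(2), of x]
        by (simp add: add.commute)
      show "\<P>(\<omega> in after M C Black. unattained r (b + d) d (\<lambda>n. C (Suc n)) x \<omega>) ^ d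
          \<le> real (b + d) / real (b + d + n * d)"
        by (rule Suc.IH[OF black]) simp
    qed simp
  qed
qed simp

text \<open>
  The same with the colours exchanged: after a black draw there are at least \<open>d\<close> black balls,
  and only the paths on which red is drawn forever remain.
\<close>
lemma prob_unattained:
  assumes urn: "polya_urn r b d M C" and rb: "0 < r" "0 < b" and d: "0 < d"
  shows "\<P>(\<omega> in M. unattained r b d C x \<omega>) = 0"
proof (rule power_decay_imp_0[OF d])
  show "\<P>(\<omega> in M. unattained r b d C x \<omega>) ^ d \<le> real r / real (r + n * d)" for n
    using urn rb(1)
  proof (induction n arbitrary: r M C)
    case (0 r M C)
    interpret prob_space M using 0 by (simp add: polya_urnD)
    show ?case using 0 by (simp add: power_le_one)
  next
    case (Suc n r M C)
    have red: "polya_urn (r + d) b d (after M C Red) (\<lambda>n. C (Suc n))"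
      and black: "polya_urn r (b + d) d (after M C Black) (\<lambda>n. C (Suc n))"
      using Suc.prems rb(2) by (auto intro: polya_urn_after_Red polya_urn_after_Black)
    show ?case
    proof (rule power_decay[OF d Suc.prems(2) rb(2)])
      show "\<P>(\<omega> in M. unattained r b d C x \<omega>) \<le> real r / real (r + b)
          * \<P>(\<omega> in after M C Red. unattained (r + d) b d (\<lambda>n. C (Suc n)) x \<omega>)"
        using prob_unattained_le[OF Suc.prems rb(2), of x]
          prob_unattained_many_black[OF black Suc.prems(2) d, of x]
        by simp
      show "\<P>(\<omega> in after M C Red. unattained (r + d) b d (\<lambda>n. C (Suc n)) x \<omega>) ^ d
          \<le> real (r + d) / real (r + d + n * d)"
        by (rule Suc.IH[OF red]) (use Suc.prems(2) in simp)
    qed simp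
  qed
qed simp

section \<open>The supports\<close>

definition attainable :: "nat \<Rightarrow> nat \<Rightarrow> nat \<Rightarrow> real set" where
  "attainable r b d = {q r b d i n | i n. i \<le> n \<and> q r b d i n \<ge> real r / real (r + b)}"

lemma supp_S_sup_subset:
  assumes urn: "polya_urn r b d M C" and rb: "0 < r" "0 < b" and d: "0 < d"
  shows "supp M (S_sup r b d C) \<subseteq> attainable r b d"
proof
  interpret prob_space M using urn by (simp add: polya_urnD)
  note [measurable] = polya_urnD(2)[OF urn] measurable_unattained
  fix x assume "x \<in> supp M (S_sup r b d C)"
  then have x: "0 < \<P>(\<omega> in M. S_sup r b d C \<omega> = x)" by (simp add: supp_def)
  have "\<exists>\<omega>. S_sup r b d C \<omega> = x \<and> (\<exists>n. Z r b d C n \<omega> = x)"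
  proof (rule ccontr)
    assume "\<not> ?thesis"
    then have "\<P>(\<omega> in M. S_sup r b d C \<omega> = x) \<le> \<P>(\<omega> in M. unattained r b d C x \<omega>)"
      by (intro finite_measure_mono) (auto simp: unattained_def)
    then show False using x prob_unattained[OF assms, of x] by simp
  qed
  then obtain \<omega> n where \<omega>: "S_sup r b d C \<omega> = x" "Z r b d C n \<omega> = x" by blast
  then have "real r / real (r + b) \<le> x"
    using Z_le_S_sup[of r b d C 0 \<omega>] by simp
  moreover obtain i where "i \<le> n" "x = q r b d i n"
    using Z_eq_q[of n r b d C \<omega>] \<omega>(2) by metis
  ultimately show "x \<in> attainable r b d" by (auto simp: attainable_def)
qed

lemma prob_S_sup_step:
  assumes urn: "polya_urn r b d M C" and rb: "0 < r" "0 < b" and x: "real r / real (r + b) \<le> x"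
  shows "real r / real (r + b) * \<P>(\<omega> in after M C Red. S_sup (r + d) b d (\<lambda>n. C (Suc n)) \<omega> = x)
    + real b / real (r + b) * \<P>(\<omega> in after M C Black. S_sup r (b + d) d (\<lambda>n. C (Suc n)) \<omega> = x)
    \<le> \<P>(\<omega> in M. S_sup r b d C \<omega> = x)"
proof -
  interpret prob_space M using urn by (simp add: polya_urnD)
  note [measurable] = polya_urnD(2)[OF urn]
  have "\<P>(\<omega> in M. M_sup r b d C \<omega> = x) \<le> \<P>(\<omega> in M. S_sup r b d C \<omega> = x)"
    using x by (intro finite_measure_mono) (auto simp: S_sup_eq_max)
  also have "\<P>(\<omega> in M. M_sup r b d C \<omega> = x)
      = real r / real (r + b) * \<P>(\<omega> in after M C Red. S_sup (r + d) b d (\<lambda>n. C (Suc n)) \<omega> = x)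
      + real b / real (r + b) * \<P>(\<omega> in after M C Black. S_sup r (b + d) d (\<lambda>n. C (Suc n)) \<omega> = x)"
    by (rule first_draw[OF urn rb]) (auto simp: M_sup_eq_S_sup)
  finally show ?thesis .
qed

lemma mixture_pos_iff:
  fixes u v s t :: real
  assumes "0 < u" "0 < v" "0 \<le> s" "0 \<le> t"
  shows "0 < u * s + v * t \<longleftrightarrow> 0 < t \<or> 0 < s"
proof (cases "0 < s")
  case True
  then show ?thesis using assms by (simp add: add_pos_nonneg)
next
  case False
  then show ?thesis using assms by (simp add: zero_less_mult_iff)
qed

lemma supp_S_sup_after:
  assumes "polya_urn r b d M C" and "0 < r" and "0 < b" and "real r / real (r + b) \<le> x"
    and "x \<in> supp (after M C Red) (S_sup (r + d) b d (\<lambda>n. C (Suc n)))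
      \<union> supp (after M C Black) (S_sup r (b + d) d (\<lambda>n. C (Suc n)))"
  shows "x \<in> supp M (S_sup r b d C)"
proof -
  have "0 < real r / real (r + b) * \<P>(\<omega> in after M C Red. S_sup (r + d) b d (\<lambda>n. C (Suc n)) \<omega> = x)
      + real b / real (r + b) * \<P>(\<omega> in after M C Black. S_sup r (b + d) d (\<lambda>n. C (Suc n)) \<omega> = x)"
    by (subst mixture_pos_iff) (use assms(2,3,5) in \<open>auto simp: supp_def\<close>)
  then show ?thesis
    using prob_S_sup_step[OF assms(1-4)] by (simp add: supp_def)
qed

text \<open>
  After a black first draw the proportion is strictly smaller than \<open>r / (r + b)\<close>, so the
  maximal inequality leaves a positive probability that it never comes back to this level.
\<close>
lemma start_in_supp:
  assumes urn: "polya_urn r b d M C" and rb: "0 < r" "0 < b" and d: "0 < d"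
  shows "real r / real (r + b) \<in> supp M (S_sup r b d C)"
proof -
  interpret prob_space M using urn by (simp add: polya_urnD)
  note [measurable] = polya_urnD(2)[OF urn]
  let ?z = "real r / real (r + b)" and ?C = "\<lambda>n. C (Suc n)"
  have black: "polya_urn r (b + d) d (after M C Black) ?C"
    using assms by (intro polya_urn_after_Black)
  interpret black: prob_space "after M C Black" using black by (simp add: polya_urnD)
  have "\<P>(\<omega> in after M C Black. \<exists>n. ?z \<le> Z r (b + d) d ?C n \<omega>) \<le> real r / real (r + (b + d)) / ?z"
    using rb by (intro prob_proportion_reaches[OF black]) auto
  also have "\<dots> < 1" using rb d by (simp add: divide_simps)
  finally have "0 < \<P>(\<omega> in after M C Black. \<not> (\<exists>n. ?z \<le> Z r (b + d) d ?C n \<omega>))"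
    by (subst black.prob_neg) auto
  then have "0 < real r / real (r + b) * \<P>(\<omega> in after M C Red. False)
      + real b / real (r + b) * \<P>(\<omega> in after M C Black. \<not> (\<exists>n. ?z \<le> Z r (b + d) d ?C n \<omega>))"
    using rb by simp
  also have "\<dots> = \<P>(\<omega> in M. C 0 \<omega> = Black \<and> \<not> (\<exists>n. ?z \<le> Z r (b + d) d ?C n \<omega>))"
    by (rule first_draw[OF urn rb, symmetric]) auto
  also have "\<dots> \<le> \<P>(\<omega> in M. S_sup r b d C \<omega> = ?z)"
  proof (intro finite_measure_mono subsetI)
    fix \<omega> assume "\<omega> \<in> {\<omega> \<in> space M. C 0 \<omega> = Black \<and> \<not> (\<exists>n. ?z \<le> Z r (b + d) d ?C n \<omega>)}"
    then have \<omega>: "\<omega> \<in> space M" "C 0 \<omega> = Black" "\<And>n. Z r (b + d) d ?C n \<omega> \<le> ?z"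
      by (auto simp: not_le intro: less_imp_le)
    then have "M_sup r b d C \<omega> \<le> ?z"
      unfolding M_sup_eq_S_sup(2)[of C \<omega>, OF \<omega>(2)] S_sup_def by (intro cSUP_least) auto
    then show "\<omega> \<in> {\<omega> \<in> space M. S_sup r b d C \<omega> = ?z}"
      using \<omega>(1) by (simp add: S_sup_eq_max)
  qed auto
  finally show ?thesis by (simp add: supp_def)
qed

text \<open>
  The value is reached by drawing all black balls first. In the induction the black draws are
  therefore made as long as more than \<open>i\<close> draws remain, and only then the red ones, so that each intermediate
  proportion is at most \<open>q r b d i n\<close> and the induction hypothesis applies.
\<close>
lemma attainable_subset_supp:
  assumes "polya_urn r b d M C" and "0 < r" and "0 < b" and d: "0 < d"
    and "i \<le> n" and "real r / real (r + b) \<le> q r b d i n"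
  shows "q r b d i n \<in> supp M (S_sup r b d C)"
  using assms(1-3,5-6)
proof (induction n arbitrary: i r b M C)
  case (0 i r b M C)
  then show ?case using start_in_supp[OF 0(1-3) d] by (simp add: q_def)
next
  case (Suc n i r b M C)
  have red: "polya_urn (r + d) b d (after M C Red) (\<lambda>n. C (Suc n))"
    and black: "polya_urn r (b + d) d (after M C Black) (\<lambda>n. C (Suc n))"
    using Suc.prems by (auto intro: polya_urn_after_Red polya_urn_after_Black)
  show ?case
  proof (rule supp_S_sup_after[OF Suc.prems(1-3,5)], cases "i \<le> n")
    case True
    have eq: "q r b d i (Suc n) = q r (b + d) d i n"
      by (simp add: q_def algebra_simps)
    have "real r / real (r + (b + d)) \<le> real r / real (r + b)"
      using Suc.prems by (intro divide_left_mono) auto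
    then have "q r (b + d) d i n \<in> supp (after M C Black) (S_sup r (b + d) d (\<lambda>n. C (Suc n)))"
      using Suc.prems True eq by (intro Suc.IH[OF black]) auto
    then show "q r b d i (Suc n) \<in> supp (after M C Red) (S_sup (r + d) b d (\<lambda>n. C (Suc n)))
        \<union> supp (after M C Black) (S_sup r (b + d) d (\<lambda>n. C (Suc n)))"
      by (simp add: eq)
  next
    case False
    then have i: "i = Suc n" using Suc.prems(4) by simp
    have eq: "q r b d i (Suc n) = q (r + d) b d n n"
      by (simp add: q_def i algebra_simps)
    have "real (r + d) / real (r + d + b) \<le> real (r + d + n * d) / real (r + d + b + n * d)"
    proof -
      have "0 < real (r + d + b)" "0 < real (r + d + b + n * d)"
        using Suc.prems(2) by (simp_all only: of_nat_0_less_iff)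
      then show ?thesis
        by (simp only: pos_divide_le_eq pos_le_divide_eq times_divide_eq_left) (simp add: algebra_simps)
    qed
    then have "q (r + d) b d n n \<in> supp (after M C Red) (S_sup (r + d) b d (\<lambda>n. C (Suc n)))"
      using Suc.prems by (intro Suc.IH[OF red]) (auto simp: q_def)
    then show "q r b d i (Suc n) \<in> supp (after M C Red) (S_sup (r + d) b d (\<lambda>n. C (Suc n)))
        \<union> supp (after M C Black) (S_sup r (b + d) d (\<lambda>n. C (Suc n)))"
      by (simp add: eq)
  qed
qed

lemma supp_S_sup:
  assumes "polya_urn r b d M C" and "0 < r" and "0 < b" and "0 < d"
  shows "supp M (S_sup r b d C) = attainable r b d"
  using supp_S_sup_subset[OF assms] attainable_subset_supp[OF assms]
  by (auto simp: attainable_def)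

lemma supp_M_sup:
  assumes urn: "polya_urn r b d M C" and rb: "0 < r" "0 < b"
  shows "supp M (M_sup r b d C) = supp (after M C Black) (S_sup r (b + d) d (\<lambda>n. C (Suc n)))
    \<union> supp (after M C Red) (S_sup (r + d) b d (\<lambda>n. C (Suc n)))"
proof -
  note [measurable] = polya_urnD(2)[OF urn]
  have eq: "\<P>(\<omega> in M. M_sup r b d C \<omega> = x)
      = real r / real (r + b) * \<P>(\<omega> in after M C Red. S_sup (r + d) b d (\<lambda>n. C (Suc n)) \<omega> = x)
      + real b / real (r + b) * \<P>(\<omega> in after M C Black. S_sup r (b + d) d (\<lambda>n. C (Suc n)) \<omega> = x)" for x
    by (rule first_draw[OF urn rb]) (auto simp: M_sup_eq_S_sup)
  have "0 < \<P>(\<omega> in M. M_sup r b d C \<omega> = x)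
      \<longleftrightarrow> 0 < \<P>(\<omega> in after M C Black. S_sup r (b + d) d (\<lambda>n. C (Suc n)) \<omega> = x)
        \<or> 0 < \<P>(\<omega> in after M C Red. S_sup (r + d) b d (\<lambda>n. C (Suc n)) \<omega> = x)" for x
    unfolding eq by (rule mixture_pos_iff) (use rb in auto)
  then show ?thesis unfolding supp_def by blast
qed

lemma attainable_1:
  assumes rb: "0 < r" "0 < b"
  shows "attainable r b 1 = {real r / real (r + b)..<1} \<inter> \<rat>"
proof (intro equalityI subsetI)
  fix x assume "x \<in> attainable r b 1"
  then show "x \<in> {real r / real (r + b)..<1} \<inter> \<rat>"
    using rb by (auto simp: attainable_def q_def)
next
  fix x :: real
  assume x: "x \<in> {real r / real (r + b)..<1} \<inter> \<rat>"
  have "0 < real r / real (r + b)" using rb by simp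
  with x have "0 < x" "x < 1" by auto
  have "x \<in> \<rat>" using x by simp
  then obtain p m :: nat where m: "m \<noteq> 0" and "\<bar>x\<bar> = real p / real m"
    by (metis Rats_abs_nat_div_natE)
  with \<open>0 < x\<close> have xpm: "x = real p / real m" by simp
  then have "0 < p"
    using \<open>0 < x\<close> by (auto intro: gr0I)
  have "real p < real m"
    using \<open>x < 1\<close> m by (simp add: xpm divide_less_eq_1)
  then have "p < m" by simp
  \<comment> \<open>The fraction is expanded by \<open>k\<close> to have at least \<open>r\<close> in the numerator and at least
    \<open>b\<close> more in the denominator.\<close>
  define k where "k = r + b"
  have "1 * k \<le> p * k" using \<open>0 < p\<close> by (intro mult_le_mono1) simp
  moreover have "r \<le> k" by (simp add: k_def)
  ultimately have "r \<le> p * k" by linarith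
  have "Suc p * k \<le> m * k" using \<open>p < m\<close> by (intro mult_le_mono1) simp
  then have k: "p * k + k \<le> m * k" by (simp only: mult_Suc add.commute)
  have le: "p * k - r \<le> m * k - (r + b)"
    using \<open>r \<le> p * k\<close> k unfolding k_def by linarith
  have "r + (p * k - r) = p * k" "r + b + (m * k - (r + b)) = m * k"
    using \<open>r \<le> p * k\<close> k by (auto simp: k_def)
  then have "q r b 1 (p * k - r) (m * k - (r + b)) = real (p * k) / real (m * k)"
    by (simp add: q_def)
  also have "\<dots> = x" using rb by (simp add: xpm k_def)
  finally have "q r b 1 (p * k - r) (m * k - (r + b)) = x" .
  with x le show "x \<in> attainable r b 1"
    unfolding attainable_def by force
qed

theorem mainTheorem3:
  fixes r b d :: nat
    and M :: "'a measure" and C :: "nat \<Rightarrow> 'a \<Rightarrow> colour"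
    and M' :: "'b measure" and C' :: "nat \<Rightarrow> 'b \<Rightarrow> colour"
    and M'' :: "'c measure" and C'' :: "nat \<Rightarrow> 'c \<Rightarrow> colour"
  assumes "r \<ge> 1" and "b \<ge> 1" and "d \<ge> 1"
    and "polya_urn r b d M C"
  shows "supp M (S_sup r b d C) = {q r b d i n | i n. i \<le> n \<and> q r b d i n \<ge> real r / real (r + b)}
    \<and> (polya_urn r (b + d) d M' C' \<and> polya_urn (r + d) b d M'' C'' \<longrightarrow>
        supp M (M_sup r b d C) =
          supp M' (S_sup r (b + d) d C') \<union> supp M'' (S_sup (r + d) b d C''))
    \<and> (d = 1 \<longrightarrow> supp M (S_sup r b d C) = {real r / real (r + b)..<1} \<inter> \<rat>)"
proof (intro conjI impI)
  have rb: "0 < r" "0 < b" and d: "0 < d" using assms by auto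
  note S = supp_S_sup[OF assms(4) rb d]
  show "supp M (S_sup r b d C) = {q r b d i n | i n. i \<le> n \<and> q r b d i n \<ge> real r / real (r + b)}"
    using S by (simp only: attainable_def)
  show "supp M (S_sup r b d C) = {real r / real (r + b)..<1} \<inter> \<rat>" if "d = 1"
    using S attainable_1[OF rb] that by simp
  assume "polya_urn r (b + d) d M' C' \<and> polya_urn (r + d) b d M'' C''"
  then show "supp M (M_sup r b d C) =
      supp M' (S_sup r (b + d) d C') \<union> supp M'' (S_sup (r + d) b d C'')"
    using supp_M_sup[OF assms(4) rb] rb d
      supp_S_sup[OF polya_urn_after_Red[OF assms(4) rb(1)]] supp_S_sup[of "r + d" b d M'' C'']
      supp_S_sup[OF polya_urn_after_Black[OF assms(4) rb]] supp_S_sup[of r "b + d" d M' C']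
    by simp
qed

end
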